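(* Let $H$ be a graph containing a cycle $C$ and two adjacent vertices neither of which has a neighbor in $V(C)$. Then the class of $H$-subdivisions does not have the induced Erdős–Pósa property.
   Context: All graphs are finite and simple. A subdivision of $H$ is a graph obtained from $H$ by repeatedly replacing an edge by a path of length $2$ through a new vertex. An induced subdivision of $H$ in $G$ is an induced subgraph of $G$ isomorphic to a subdivision of $H$. The class of $H$-subdivisions has the induced Erdős–Pósa property if there is a function $f:\mathbb N\to\mathbb R$ such that for every graph $G$ and every positive integer $k$, $G$ contains either $k$ pairwise vertex-disjoint induced subdivisions of $H$ or a set of at most $f(k)$ vertices meeting every induced subdivision of $H$. *)

theory Defs
  imports Complex_Main
begin

type_synonym 'v graph = "'v set \<times> 'v set set"

definition verts :: "'v graph \<Rightarrow> 'v set" where "verts G = fst G"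
definition edges :: "'v graph \<Rightarrow> 'v set set" where "edges G = snd G"

definition wf_graph :: "'v graph \<Rightarrow> bool" where
  "wf_graph G \<longleftrightarrow> finite (verts G) \<and> (\<forall>e\<in>edges G. e \<subseteq> verts G \<and> card e = 2)"

definition adj :: "'v graph \<Rightarrow> 'v \<Rightarrow> 'v \<Rightarrow> bool" where
  "adj G u v \<longleftrightarrow> {u, v} \<in> edges G"

definition graph_iso :: "'a graph \<Rightarrow> 'b graph \<Rightarrow> bool" where
  "graph_iso G H \<longleftrightarrow> (\<exists>f. bij_betw f (verts G) (verts H) \<and>
     (\<forall>x\<in>verts G. \<forall>y\<in>verts G. adj G x y \<longleftrightarrow> adj H (f x) (f y)))"

definition subdiv_step :: "'v graph \<Rightarrow> 'v graph \<Rightarrow> bool" where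
  "subdiv_step G G' \<longleftrightarrow> (\<exists>u v w. {u, v} \<in> edges G \<and> w \<notin> verts G \<and>
      G' = (insert w (verts G), (edges G - {{u, v}}) \<union> {{u, w}, {w, v}}))"

text \<open>The copy of H on the vertex type 'a + nat, which has infinitely many fresh vertices.\<close>
definition lift_graph :: "'a graph \<Rightarrow> ('a + nat) graph" where
  "lift_graph H = (Inl ` verts H, (\<lambda>e. Inl ` e) ` edges H)"

definition is_subdivision_of :: "'b graph \<Rightarrow> 'a graph \<Rightarrow> bool" where
  "is_subdivision_of S H \<longleftrightarrow>
     (\<exists>H0. subdiv_step\<^sup>*\<^sup>* (lift_graph H) H0 \<and> graph_iso H0 S)"

definition induced_subgraph :: "'v graph \<Rightarrow> 'v set \<Rightarrow> 'v graph" where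
  "induced_subgraph G S = (S, {e \<in> edges G. e \<subseteq> S})"

definition induced_subdiv :: "'v graph \<Rightarrow> 'a graph \<Rightarrow> 'v set \<Rightarrow> bool" where
  "induced_subdiv G H S \<longleftrightarrow> S \<subseteq> verts G \<and> is_subdivision_of (induced_subgraph G S) H"

text \<open>Induced Erdos-Posa property for H-subdivisions. Host graphs are taken on vertex type nat,
  which loses no generality since every finite graph is isomorphic to one on nat.\<close>
definition induced_EP :: "'a graph \<Rightarrow> bool" where
  "induced_EP H \<longleftrightarrow> (\<exists>f :: nat \<Rightarrow> real. \<forall>G :: nat graph. \<forall>k::nat.
     wf_graph G \<and> k > 0 \<longrightarrow>
       (\<exists>F. card F = k \<and> pairwise disjnt F \<and> (\<forall>S\<in>F. induced_subdiv G H S))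
     \<or> (\<exists>X. X \<subseteq> verts G \<and> real (card X) \<le> f k \<and>
            (\<forall>S. induced_subdiv G H S \<longrightarrow> S \<inter> X \<noteq> {})))"

definition is_cycle :: "'v graph \<Rightarrow> 'v list \<Rightarrow> bool" where
  "is_cycle G cs \<longleftrightarrow> length cs \<ge> 3 \<and> distinct cs \<and> set cs \<subseteq> verts G \<and>
     (\<forall>i < length cs. adj G (cs ! i) (cs ! ((i + 1) mod length cs)))"

end

theory Submission
  imports Defs
begin

text \<open>The cycle of \<open>H\<close> is a vertex set inducing minimum degree at least 2 and anticomplete to
  an edge; every subdivision of \<open>H\<close> inherits such a far core. Let \<open>T\<close> be \<open>H\<close> with every edge
  subdivided \<open>2 N + 1\<close> times. The host graph consists of \<open>N\<close> copies of \<open>T\<close>, where on each edge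
  of \<open>H\<close> the subdividing vertex number \<open>2 j\<close> of copy \<open>i\<close> is identified with number \<open>2 i\<close> of
  copy \<open>j\<close>, and all unidentified vertices of distinct copies are made adjacent. The identified
  vertices are independent, so an edge has an unidentified end, which confines a core
  anticomplete to it to a single copy of \<open>T\<close>. There the core contains an entire subdivided edge
  of \<open>H\<close>. Two such paths for the same edge of \<open>H\<close> share a vertex, so at most \<open>card (edges H)\<close>
  induced subdivisions are pairwise disjoint. Each vertex lies in at most two of the \<open>N\<close>
  copies, so a hitting set has at least \<open>N / 2\<close> vertices.\<close>

section \<open>Graphs and isomorphisms\<close>

lemma verts_Pair [simp]: "verts (V, E) = V"
  by (simp add: verts_def)

lemma edges_Pair [simp]: "edges (V, E) = E"
  by (simp add: edges_def)

lemma graph_collapse [simp]: "(verts G, edges G) = G"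
  by (simp add: verts_def edges_def)

lemma adj_sym: "adj G x y \<longleftrightarrow> adj G y x"
  by (simp add: adj_def insert_commute)

lemma wf_graph_adjD:
  assumes "wf_graph G" "adj G x y"
  shows "x \<in> verts G" "y \<in> verts G" "x \<noteq> y"
proof -
  have "{x, y} \<subseteq> verts G" "card {x, y} = 2"
    using assms unfolding wf_graph_def adj_def by blast+
  then show "x \<in> verts G" "y \<in> verts G" "x \<noteq> y" by auto
qed

lemma wf_graph_finite_edges:
  assumes "wf_graph G"
  shows "finite (edges G)"
  using assms by (auto simp: wf_graph_def intro: finite_subset[of _ "Pow (verts G)"])

lemma verts_induced_subgraph [simp]: "verts (induced_subgraph G S) = S"
  by (simp add: induced_subgraph_def)

lemma adj_induced_subgraph [simp]: "adj (induced_subgraph G S) x y \<longleftrightarrow> adj G x y \<and> x \<in> S \<and> y \<in> S"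
  by (auto simp: adj_def induced_subgraph_def)

definition iso_map :: "('a \<Rightarrow> 'b) \<Rightarrow> 'a graph \<Rightarrow> 'b graph \<Rightarrow> bool" where
  "iso_map f G G' \<longleftrightarrow> bij_betw f (verts G) (verts G') \<and>
     (\<forall>x\<in>verts G. \<forall>y\<in>verts G. adj G x y \<longleftrightarrow> adj G' (f x) (f y))"

lemma graph_iso_iff: "graph_iso G G' \<longleftrightarrow> (\<exists>f. iso_map f G G')"
  by (simp add: graph_iso_def iso_map_def)

lemma iso_map_in_verts: "iso_map f G G' \<Longrightarrow> x \<in> verts G \<Longrightarrow> f x \<in> verts G'"
  by (auto simp: iso_map_def bij_betw_def)

lemma iso_map_inj_on: "iso_map f G G' \<Longrightarrow> inj_on f (verts G)"
  by (simp add: iso_map_def bij_betw_def)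

lemma iso_map_adj:
  "iso_map f G G' \<Longrightarrow> x \<in> verts G \<Longrightarrow> y \<in> verts G \<Longrightarrow> adj G' (f x) (f y) \<longleftrightarrow> adj G x y"
  by (simp add: iso_map_def)

lemma iso_map_inv:
  assumes "iso_map f G G'"
  shows "iso_map (inv_into (verts G) f) G' G"
  using assms unfolding iso_map_def
  by (auto simp: bij_betw_inv_into bij_betw_inv_into_right inv_into_into bij_betw_imp_surj_on)

lemma iso_map_comp:
  assumes "iso_map f G G'" "iso_map g G' G''"
  shows "iso_map (g \<circ> f) G G''"
  using assms iso_map_in_verts[OF assms(1)] unfolding iso_map_def
  by (auto intro: bij_betw_trans)

lemma iso_map_induced_subgraph:
  assumes "iso_map f G G'" "S \<subseteq> verts G"
  shows "iso_map f (induced_subgraph G S) (induced_subgraph G' (f ` S))"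
  using assms unfolding iso_map_def by (auto intro: bij_betw_subset)

definition map_graph :: "('a \<Rightarrow> 'b) \<Rightarrow> 'a graph \<Rightarrow> 'b graph" where
  "map_graph f G = (f ` verts G, (`) f ` edges G)"

lemma verts_map_graph [simp]: "verts (map_graph f G) = f ` verts G"
  by (simp add: map_graph_def)

lemma wf_graph_map_graph:
  assumes "wf_graph G" "inj_on f (verts G)"
  shows "wf_graph (map_graph f G)"
proof -
  have "f ` e \<subseteq> f ` verts G \<and> card (f ` e) = 2" if "e \<in> edges G" for e
    using assms that card_image[OF inj_on_subset[OF assms(2), of e]] by (auto simp: wf_graph_def)
  with assms(1) show ?thesis by (auto simp: wf_graph_def map_graph_def)
qed

lemma iso_map_map_graph:
  assumes "wf_graph G" "inj_on f (verts G)"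
  shows "iso_map f G (map_graph f G)"
proof -
  have "f ` {x, y} \<in> (`) f ` edges G \<longleftrightarrow> {x, y} \<in> edges G" if "x \<in> verts G" "y \<in> verts G" for x y
    using assms that
    by (intro inj_on_image_mem_iff[OF inj_on_image_Pow[OF assms(2)]]) (auto simp: wf_graph_def)
  with assms(2) show ?thesis
    by (simp add: iso_map_def bij_betw_def adj_def map_graph_def)
qed

section \<open>Subdivisions\<close>

definition subdivide_edge :: "'v graph \<Rightarrow> 'v \<Rightarrow> 'v \<Rightarrow> 'v \<Rightarrow> 'v graph" where
  "subdivide_edge G u v w = (insert w (verts G), (edges G - {{u, v}}) \<union> {{u, w}, {w, v}})"

lemma subdiv_step_iff:
  "subdiv_step G G' \<longleftrightarrow> (\<exists>u v w. adj G u v \<and> w \<notin> verts G \<and> G' = subdivide_edge G u v w)"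
  by (simp add: subdiv_step_def adj_def subdivide_edge_def)

lemma verts_subdivide_edge [simp]: "verts (subdivide_edge G u v w) = insert w (verts G)"
  by (simp add: subdivide_edge_def)

lemma adj_subdivide_edge [simp]:
  "adj (subdivide_edge G u v w) x y \<longleftrightarrow>
     adj G x y \<and> {x, y} \<noteq> {u, v} \<or> x = w \<and> y \<in> {u, v} \<or> y = w \<and> x \<in> {u, v}"
  by (auto simp: subdivide_edge_def adj_def doubleton_eq_iff)

lemma wf_graph_subdivide_edge:
  assumes "wf_graph G" "adj G u v" "w \<notin> verts G"
  shows "wf_graph (subdivide_edge G u v w)"
  using assms wf_graph_adjD[OF assms(1,2)]
  by (auto simp: wf_graph_def subdivide_edge_def card_insert_if)

lemma wf_graph_subdiv_step: "wf_graph G \<Longrightarrow> subdiv_step G G' \<Longrightarrow> wf_graph G'"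
  by (auto simp: subdiv_step_iff wf_graph_subdivide_edge)

lemma wf_graph_subdiv_steps:
  assumes "subdiv_step\<^sup>*\<^sup>* G G'" "wf_graph G"
  shows "wf_graph G'"
  using assms by (induction rule: rtranclp_induct) (auto intro: wf_graph_subdiv_step)

lemma iso_map_subdivide_edge:
  assumes iso: "iso_map f G G'" and uv: "u \<in> verts G" "v \<in> verts G"
    and wf: "wf_graph G" "wf_graph G'" and fresh: "w \<notin> verts G" "w' \<notin> verts G'"
  shows "iso_map (f(w := w')) (subdivide_edge G u v w) (subdivide_edge G' (f u) (f v) w')"
    (is "iso_map ?f ?G ?G'")
proof -
  have no_adj: "\<not> adj G w x" "\<not> adj G x w" "\<not> adj G' w' y" "\<not> adj G' y w'" for x y
    using wf_graph_adjD[OF wf(1)] wf_graph_adjD[OF wf(2)] fresh by blast+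
  have eq_iff: "f x = f y \<longleftrightarrow> x = y" if "x \<in> verts G" "y \<in> verts G" for x y
    using iso_map_inj_on[OF iso] that by (rule inj_on_eq_iff)
  have neq: "f x \<noteq> w'" "x \<noteq> w" if "x \<in> verts G" for x
    using iso_map_in_verts[OF iso that] that fresh by blast+
  have "bij_betw ?f (insert w (verts G)) (insert w' (verts G'))"
    using iso fresh neq by (auto simp: iso_map_def bij_betw_def inj_on_def)
  moreover have "adj ?G x y \<longleftrightarrow> adj ?G' (?f x) (?f y)"
    if "x \<in> insert w (verts G)" "y \<in> insert w (verts G)" for x y
    using that uv fresh
    by (auto simp: eq_iff neq neq[symmetric] no_adj iso_map_adj[OF iso] doubleton_eq_iff)
  ultimately show ?thesis by (simp add: iso_map_def)
qed

lemma lift_graph_eq_map_graph: "lift_graph H = map_graph Inl H"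
  by (simp add: lift_graph_def map_graph_def)

lemma wf_graph_lift_graph: "wf_graph H \<Longrightarrow> wf_graph (lift_graph H)"
  by (simp add: lift_graph_eq_map_graph wf_graph_map_graph)

lemma iso_map_lift_graph: "wf_graph H \<Longrightarrow> iso_map Inl H (lift_graph H)"
  by (simp add: lift_graph_eq_map_graph iso_map_map_graph)

lemma is_subdivision_of_iso_map:
  assumes "is_subdivision_of S H" "iso_map f S S'"
  shows "is_subdivision_of S' H"
  using assms iso_map_comp unfolding is_subdivision_of_def graph_iso_iff by blast

lemma is_subdivision_of_map_graph:
  assumes "wf_graph H" "inj_on f (verts H)"
  shows "is_subdivision_of (map_graph f H) H"
proof -
  have "is_subdivision_of H H"
    using iso_map_inv[OF iso_map_lift_graph[OF assms(1)]]
    unfolding is_subdivision_of_def graph_iso_iff by blast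
  then show ?thesis using iso_map_map_graph[OF assms] by (rule is_subdivision_of_iso_map)
qed

lemma is_subdivision_of_subdiv_step:
  assumes wf: "wf_graph H" "wf_graph S"
    and sub: "is_subdivision_of S H" and step: "subdiv_step S S'"
  shows "is_subdivision_of S' H"
proof -
  obtain H0 g where steps: "subdiv_step\<^sup>*\<^sup>* (lift_graph H) H0" and "iso_map g H0 S"
    using sub by (auto simp: is_subdivision_of_def graph_iso_iff)
  then obtain f where f: "iso_map f S H0" using iso_map_inv by blast
  obtain u v w where uv: "adj S u v" and w: "w \<notin> verts S" and S': "S' = subdivide_edge S u v w"
    using step by (auto simp: subdiv_step_iff)
  have uv_verts: "u \<in> verts S" "v \<in> verts S" using wf_graph_adjD[OF wf(2) uv] by blast+
  have wf_H0: "wf_graph H0"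
    using wf_graph_subdiv_steps[OF steps wf_graph_lift_graph[OF wf(1)]] .
  then have "finite (Inr -` verts H0 :: nat set)"
    by (simp add: wf_graph_def finite_vimageI)
  then obtain n where n: "Inr n \<notin> verts H0"
    using ex_new_if_finite[OF infinite_UNIV_nat] by blast
  have "subdiv_step H0 (subdivide_edge H0 (f u) (f v) (Inr n))"
    using n uv iso_map_adj[OF f uv_verts] by (auto simp: subdiv_step_iff)
  with steps have "subdiv_step\<^sup>*\<^sup>* (lift_graph H) (subdivide_edge H0 (f u) (f v) (Inr n))"
    by (rule rtranclp.rtrancl_into_rtrancl)
  then show ?thesis
    using iso_map_inv[OF iso_map_subdivide_edge[OF f uv_verts wf(2) wf_H0 w n]]
    unfolding is_subdivision_of_def graph_iso_iff S' by blast
qed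

lemma is_subdivision_of_subdiv_steps:
  assumes "subdiv_step\<^sup>*\<^sup>* S S'" "wf_graph H" "wf_graph S" "is_subdivision_of S H"
  shows "is_subdivision_of S' H"
  using assms
proof (induction rule: rtranclp_induct)
  case (step S1 S2)
  then show ?case
    using is_subdivision_of_subdiv_step wf_graph_subdiv_steps by blast
qed

section \<open>Packings and hitting sets\<close>

definition induced_packing :: "'v graph \<Rightarrow> 'a graph \<Rightarrow> 'v set set \<Rightarrow> bool" where
  "induced_packing G H F \<longleftrightarrow> pairwise disjnt F \<and> (\<forall>S\<in>F. induced_subdiv G H S)"

definition hitting_set :: "'v graph \<Rightarrow> 'a graph \<Rightarrow> 'v set \<Rightarrow> bool" where
  "hitting_set G H X \<longleftrightarrow> X \<subseteq> verts G \<and> (\<forall>S. induced_subdiv G H S \<longrightarrow> S \<inter> X \<noteq> {})"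

lemma induced_subdiv_image:
  assumes iso: "iso_map f G G'" and sub: "induced_subdiv G H S"
  shows "induced_subdiv G' H (f ` S)"
proof -
  have S: "S \<subseteq> verts G" "is_subdivision_of (induced_subgraph G S) H"
    using sub by (auto simp: induced_subdiv_def)
  then show ?thesis
    using is_subdivision_of_iso_map[OF S(2) iso_map_induced_subgraph[OF iso S(1)]]
      iso_map_in_verts[OF iso] by (auto simp: induced_subdiv_def)
qed

lemma induced_packing_image:
  assumes iso: "iso_map f G G'" and F: "induced_packing G H F"
  shows "induced_packing G' H ((`) f ` F)" and "card ((`) f ` F) = card F"
proof -
  have sub: "F \<subseteq> Pow (verts G)"
    using F by (auto simp: induced_packing_def induced_subdiv_def)
  have inj: "inj_on f (verts G)" using iso by (rule iso_map_inj_on)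
  have "inj_on f (\<Union>F)" using inj by (rule inj_on_subset) (use sub in auto)
  then have "pairwise disjnt ((`) f ` F)"
    using F by (auto simp: induced_packing_def pairwise_def disjnt_inj_on_iff)
  then show "induced_packing G' H ((`) f ` F)"
    using F induced_subdiv_image[OF iso] unfolding induced_packing_def by blast
  show "card ((`) f ` F) = card F"
    using inj_on_subset[OF inj_on_image_Pow[OF inj] sub] by (rule card_image)
qed

lemma hitting_set_image:
  assumes iso: "iso_map f G G'" and X: "hitting_set G H X"
  shows "hitting_set G' H (f ` X)"
proof -
  let ?g = "inv_into (verts G) f"
  have "S \<inter> f ` X \<noteq> {}" if "induced_subdiv G' H S" for S
  proof -
    have "induced_subdiv G H (?g ` S)"
      using iso_map_inv[OF iso] that by (rule induced_subdiv_image)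
    then obtain y where y: "y \<in> S" "?g y \<in> X"
      using X unfolding hitting_set_def by blast
    moreover have "f (?g y) = y"
      using iso that y(1) by (auto simp: iso_map_def induced_subdiv_def bij_betw_inv_into_right)
    ultimately show ?thesis by force
  qed
  moreover have "f ` X \<subseteq> verts G'"
    using X iso_map_in_verts[OF iso] by (auto simp: hitting_set_def)
  ultimately show ?thesis by (simp add: hitting_set_def)
qed

lemma induced_EP_iff:
  "induced_EP H \<longleftrightarrow> (\<exists>f :: nat \<Rightarrow> real. \<forall>(G :: nat graph) k. wf_graph G \<and> k > 0 \<longrightarrow>
     (\<exists>F. card F = k \<and> induced_packing G H F) \<or> (\<exists>X. hitting_set G H X \<and> real (card X) \<le> f k))"
  unfolding induced_EP_def induced_packing_def hitting_set_def
  by (simp add: conj_commute conj_left_commute)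

lemma not_induced_EP_if_bounded_packings:
  fixes G :: "nat \<Rightarrow> 'b graph"
  assumes wf: "\<And>N. wf_graph (G N)"
    and packing: "\<And>N F. induced_packing (G N) H F \<Longrightarrow> card F \<le> c"
    and hitting: "\<And>N X. hitting_set (G N) H X \<Longrightarrow> N \<le> card X"
  shows "\<not> induced_EP H"
proof
  assume "induced_EP H"
  then obtain f :: "nat \<Rightarrow> real" where f: "\<And>(G :: nat graph) k. wf_graph G \<Longrightarrow> k > 0 \<Longrightarrow>
     (\<exists>F. card F = k \<and> induced_packing G H F) \<or> (\<exists>X. hitting_set G H X \<and> real (card X) \<le> f k)"
    unfolding induced_EP_iff by blast
  obtain N :: nat where N: "f (Suc c) < real N" using reals_Archimedean2 by blast
  have "finite (verts (G N))" using wf[of N] by (simp add: wf_graph_def)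
  then obtain h :: "'b \<Rightarrow> nat" where h: "inj_on h (verts (G N))"
    using finite_imp_inj_to_nat_seg by blast
  obtain g where g: "iso_map g (map_graph h (G N)) (G N)"
    using iso_map_inv[OF iso_map_map_graph[OF wf h]] by blast
  from f[OF wf_graph_map_graph[OF wf h], of "Suc c"]
  consider (large_packing) F where "card F = Suc c" "induced_packing (map_graph h (G N)) H F"
    | (small_hitting_set) X where "hitting_set (map_graph h (G N)) H X" "real (card X) \<le> f (Suc c)"
    by blast
  then show False
  proof cases
    case large_packing
    then show False
      using packing induced_packing_image[OF g large_packing(2)]
      by (metis not_less_eq_eq order_refl)
  next
    case small_hitting_set
    have "X \<subseteq> verts (map_graph h (G N))" using small_hitting_set(1) by (simp add: hitting_set_def)
    then have "card (g ` X) = card X"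
      using inj_on_subset[OF iso_map_inj_on[OF g]] card_image by blast
    then show False
      using hitting[OF hitting_set_image[OF g small_hitting_set(1)]] small_hitting_set(2) N by simp
  qed
qed

section \<open>Far cores\<close>

definition min_degree_2 :: "'v graph \<Rightarrow> 'v set \<Rightarrow> bool" where
  "min_degree_2 G D \<longleftrightarrow> D \<subseteq> verts G \<and> D \<noteq> {} \<and>
     (\<forall>d\<in>D. \<exists>x\<in>D. \<exists>y\<in>D. x \<noteq> y \<and> adj G d x \<and> adj G d y)"

definition far_core :: "'v graph \<Rightarrow> 'v set \<Rightarrow> bool" where
  "far_core G D \<longleftrightarrow> min_degree_2 G D \<and>
     (\<exists>a\<in>verts G. \<exists>b\<in>verts G. adj G a b \<and> (\<forall>d\<in>D. \<not> adj G a d \<and> \<not> adj G b d))"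

lemma min_degree_2D:
  assumes "min_degree_2 G D" "d \<in> D"
  obtains x y where "x \<in> D" "y \<in> D" "x \<noteq> y" "adj G d x" "adj G d y"
  using assms unfolding min_degree_2_def by blast

lemma min_degree_2_cycle:
  assumes "is_cycle G cs"
  shows "min_degree_2 G (set cs)"
  unfolding min_degree_2_def
proof (intro conjI ballI)
  let ?n = "length cs"
  have n: "?n \<ge> 3" and dist: "distinct cs"
    and adj: "\<And>i. i < ?n \<Longrightarrow> adj G (cs ! i) (cs ! ((i + 1) mod ?n))"
    using assms by (auto simp: is_cycle_def)
  show "set cs \<subseteq> verts G" using assms by (simp add: is_cycle_def)
  show "set cs \<noteq> {}" using n by auto
  fix d assume "d \<in> set cs"
  then obtain i where i: "i < ?n" "d = cs ! i" by (auto simp: in_set_conv_nth)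
  define pred where "pred = (if i = 0 then ?n - 1 else i - 1)"
  define succ where "succ = (if i = ?n - 1 then 0 else i + 1)"
  have pred: "pred < ?n" "(pred + 1) mod ?n = i" and succ: "succ < ?n" "(i + 1) mod ?n = succ"
    and neq: "pred \<noteq> succ"
    using i n by (auto simp: pred_def succ_def mod_Suc)
  have "adj G d (cs ! pred)" using adj[OF pred(1)] pred(2) i(2) by (simp add: adj_sym)
  moreover have "adj G d (cs ! succ)" using adj[OF i(1)] succ(2) i(2) by simp
  moreover have "cs ! pred \<noteq> cs ! succ"
    using pred(1) succ(1) neq dist by (simp add: nth_eq_iff_index_eq)
  ultimately show "\<exists>x\<in>set cs. \<exists>y\<in>set cs. x \<noteq> y \<and> adj G d x \<and> adj G d y"
    using pred(1) succ(1) nth_mem by blast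
qed

lemma min_degree_2_image:
  assumes iso: "iso_map f G G'" and D: "min_degree_2 G D"
  shows "min_degree_2 G' (f ` D)"
  unfolding min_degree_2_def
proof (intro conjI ballI)
  have DV: "D \<subseteq> verts G" "D \<noteq> {}" using D by (auto simp: min_degree_2_def)
  then show "f ` D \<subseteq> verts G'" "f ` D \<noteq> {}" using iso_map_in_verts[OF iso] by auto
  fix d' assume "d' \<in> f ` D"
  then obtain d where d: "d \<in> D" "d' = f d" by blast
  obtain x y where xy: "x \<in> D" "y \<in> D" "x \<noteq> y" "adj G d x" "adj G d y"
    using D d(1) by (rule min_degree_2D)
  have "f x \<noteq> f y"
    using xy DV inj_onD[OF iso_map_inj_on[OF iso]] by blast
  moreover have "adj G' d' (f x)" "adj G' d' (f y)"
    using xy d DV iso_map_adj[OF iso] by blast+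
  ultimately show "\<exists>x\<in>f ` D. \<exists>y\<in>f ` D. x \<noteq> y \<and> adj G' d' x \<and> adj G' d' y"
    using xy by blast
qed

lemma min_degree_2_induced_subgraph:
  assumes "S \<subseteq> verts G"
  shows "min_degree_2 (induced_subgraph G S) D \<longleftrightarrow> D \<subseteq> S \<and> min_degree_2 G D"
  using assms unfolding min_degree_2_def verts_induced_subgraph adj_induced_subgraph by blast

lemma min_degree_2_subdivide_edge:
  assumes uv: "u \<noteq> v" and w: "w \<notin> verts G" and D: "min_degree_2 G D"
  shows "min_degree_2 (subdivide_edge G u v w) (if u \<in> D \<and> v \<in> D then insert w D else D)"
    (is "min_degree_2 ?G ?D")
  unfolding min_degree_2_def
proof (intro conjI ballI)
  have DV: "D \<subseteq> verts G" "D \<noteq> {}" using D by (auto simp: min_degree_2_def)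
  then show "?D \<subseteq> verts ?G" "?D \<noteq> {}" by auto
  have "w \<notin> D" using DV w by blast
  fix d assume d: "d \<in> ?D"
  show "\<exists>x\<in>?D. \<exists>y\<in>?D. x \<noteq> y \<and> adj ?G d x \<and> adj ?G d y"
  proof (cases "d = w")
    case True
    then have "u \<in> D" "v \<in> D" using d \<open>w \<notin> D\<close> by (auto split: if_splits)
    then show ?thesis
      using True uv by (intro bexI[of _ u] bexI[of _ v]) auto
  next
    case False
    then have "d \<in> D" using d by (auto split: if_splits)
    with D obtain x y where xy: "x \<in> D" "y \<in> D" "x \<noteq> y" "adj G d x" "adj G d y"
      by (rule min_degree_2D)
    \<comment> \<open>Reroute through \<open>w\<close> the neighbour that the subdivision cuts off.\<close>
    define reroute where "reroute z = (if {d, z} = {u, v} then w else z)" for z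
    have "reroute z \<in> ?D \<and> adj ?G d (reroute z)" if "z \<in> D" "adj G d z" for z
      using that \<open>d \<in> D\<close> by (auto simp: reroute_def doubleton_eq_iff)
    moreover have "reroute x \<noteq> reroute y"
      using xy \<open>w \<notin> D\<close> by (auto simp: reroute_def doubleton_eq_iff)
    ultimately show ?thesis using xy by blast
  qed
qed

lemma far_core_image:
  assumes iso: "iso_map f G G'" and D: "far_core G D"
  shows "far_core G' (f ` D)"
proof -
  have DV: "D \<subseteq> verts G" using D by (simp add: far_core_def min_degree_2_def)
  obtain a b where ab: "a \<in> verts G" "b \<in> verts G" "adj G a b"
    and anti: "\<And>d. d \<in> D \<Longrightarrow> \<not> adj G a d \<and> \<not> adj G b d"
    using D by (auto simp: far_core_def)
  have "\<forall>d\<in>f ` D. \<not> adj G' (f a) d \<and> \<not> adj G' (f b) d"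
    using anti ab DV iso_map_adj[OF iso] by blast
  moreover have "f a \<in> verts G'" "f b \<in> verts G'" "adj G' (f a) (f b)"
    using ab iso_map_in_verts[OF iso] iso_map_adj[OF iso] by blast+
  ultimately show ?thesis
    using min_degree_2_image[OF iso] D unfolding far_core_def by blast
qed

lemma far_core_induced_subgraphD:
  assumes S: "S \<subseteq> verts G" and D: "far_core (induced_subgraph G S) D"
  shows "D \<subseteq> S" "far_core G D"
proof -
  have DS: "D \<subseteq> S" "min_degree_2 G D"
    using D by (simp_all add: far_core_def min_degree_2_induced_subgraph[OF S])
  obtain a b where "a \<in> S" "b \<in> S" "adj G a b" "\<forall>d\<in>D. \<not> adj G a d \<and> \<not> adj G b d"
    using D DS(1) by (auto simp: far_core_def)
  then show "D \<subseteq> S" "far_core G D"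
    using DS S unfolding far_core_def by blast+
qed

lemma far_core_subdivide_edge:
  assumes wf: "wf_graph G" and uv: "adj G u v" and w: "w \<notin> verts G" and D: "far_core G D"
  shows "far_core (subdivide_edge G u v w) (if u \<in> D \<and> v \<in> D then insert w D else D)"
    (is "far_core ?G ?D")
proof -
  have uv_verts: "u \<in> verts G" "v \<in> verts G" "u \<noteq> v" using wf_graph_adjD[OF wf uv] .
  have DV: "D \<subseteq> verts G" using D by (simp add: far_core_def min_degree_2_def)
  obtain a b where ab: "a \<in> verts G" "b \<in> verts G" "adj G a b"
    and anti: "\<And>d. d \<in> D \<Longrightarrow> \<not> adj G a d \<and> \<not> adj G b d"
    using D by (auto simp: far_core_def)
  have abD: "a \<notin> D" "b \<notin> D" using anti ab(3) adj_sym[of G a b] by blast+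
  have no_adj_w: "\<not> adj G x w" for x using wf_graph_adjD(2)[OF wf] w by blast
  have "\<exists>a'\<in>verts ?G. \<exists>b'\<in>verts ?G. adj ?G a' b' \<and> (\<forall>d\<in>?D. \<not> adj ?G a' d \<and> \<not> adj ?G b' d)"
  proof (cases "{a, b} = {u, v}")
    case True
    then have "u \<notin> D" "v \<notin> D" using abD by (auto simp: doubleton_eq_iff)
    moreover have "\<not> adj ?G u d \<and> \<not> adj ?G w d" if "d \<in> D" for d
      using that anti[OF that] True w DV uv_verts \<open>u \<notin> D\<close> \<open>v \<notin> D\<close> wf_graph_adjD(1)[OF wf]
      by (auto simp: doubleton_eq_iff)
    ultimately show ?thesis
      using uv_verts by (intro bexI[of _ u] bexI[of _ w]) auto
  next
    case False
    have "\<not> adj ?G a d \<and> \<not> adj ?G b d" if "d \<in> ?D" for d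
      using that anti ab w abD DV no_adj_w by (auto split: if_splits)
    then show ?thesis
      using ab False by (intro bexI[of _ a] bexI[of _ b]) auto
  qed
  then show ?thesis
    using min_degree_2_subdivide_edge[OF uv_verts(3) w] D unfolding far_core_def by blast
qed

lemma far_core_subdiv_steps:
  assumes "subdiv_step\<^sup>*\<^sup>* G G'" "wf_graph G" "far_core G D"
  shows "\<exists>D'. far_core G' D'"
  using assms
proof (induction rule: rtranclp_induct)
  case (step G1 G2)
  then obtain D1 where D1: "far_core G1 D1" by blast
  have wf: "wf_graph G1" using step.hyps(1) step.prems(1) by (rule wf_graph_subdiv_steps)
  obtain u v w where uv: "adj G1 u v" and w: "w \<notin> verts G1" and G2: "G2 = subdivide_edge G1 u v w"
    using step.hyps(2) unfolding subdiv_step_iff by blast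
  show ?case using far_core_subdivide_edge[OF wf uv w D1] G2 by blast
qed blast

lemma far_core_induced_subdiv:
  assumes wf: "wf_graph H" and D: "far_core H D" and sub: "induced_subdiv G H S"
  shows "\<exists>D'\<subseteq>S. far_core G D'"
proof -
  obtain H0 f where steps: "subdiv_step\<^sup>*\<^sup>* (lift_graph H) H0"
    and f: "iso_map f H0 (induced_subgraph G S)"
    and S: "S \<subseteq> verts G"
    using sub by (auto simp: induced_subdiv_def is_subdivision_of_def graph_iso_iff)
  obtain D0 where "far_core H0 D0"
    using far_core_subdiv_steps[OF steps wf_graph_lift_graph[OF wf]]
      far_core_image[OF iso_map_lift_graph[OF wf] D] by blast
  then have "far_core (induced_subgraph G S) (f ` D0)" by (rule far_core_image[OF f])
  then show ?thesis using far_core_induced_subgraphD[OF S] by blast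
qed

section \<open>Uniform subdivisions\<close>

definition path_edges :: "(nat \<Rightarrow> 'v) \<Rightarrow> nat \<Rightarrow> 'v set set" where
  "path_edges p n = (\<lambda>k. {p k, p (Suc k)}) ` {..n}"

lemma path_edges_Suc: "path_edges p (Suc n) = insert {p 0, p 1} (path_edges (p \<circ> Suc) n)"
  by (simp add: path_edges_def atMost_Suc_eq_insert_0 image_image)

lemma subdiv_steps_path:
  assumes "wf_graph G" "{p 0, p (Suc n)} \<in> edges G" "inj_on p {1..n}" "p ` {1..n} \<inter> verts G = {}"
  shows "subdiv_step\<^sup>*\<^sup>* G
    (verts G \<union> p ` {1..n}, edges G - {{p 0, p (Suc n)}} \<union> path_edges p n)"
  using assms
proof (induction n arbitrary: G p)
  case 0
  then have "G = (verts G, edges G - {{p 0, p 1}} \<union> path_edges p 0)"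
    by (auto simp: path_edges_def verts_def edges_def prod_eq_iff)
  then show ?case by simp
next
  case (Suc n)
  let ?e = "{p 0, p (Suc (Suc n))}" and ?q = "p \<circ> Suc"
  let ?G = "subdivide_edge G (p 0) (p (Suc (Suc n))) (p 1)"
  have e: "adj G (p 0) (p (Suc (Suc n)))" using Suc.prems(2) by (simp add: adj_def)
  have fresh: "p 1 \<notin> verts G" using Suc.prems(4) by fastforce
  have interval: "{1..Suc n} = insert 1 (Suc ` {1..n})"
    by auto
  have inner: "p ` {1..Suc n} = insert (p 1) (?q ` {1..n})"
    unfolding interval by (simp only: image_insert image_comp)
  have inj: "inj_on p (Suc ` {1..n})" "p 1 \<notin> p ` Suc ` {1..n}"
    using Suc.prems(3) unfolding interval by auto
  have new_end: "p 1 \<noteq> p 0" "p 0 \<noteq> p (Suc (Suc n))" "{p 1, p (Suc (Suc n))} \<notin> edges G"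
    using fresh wf_graph_adjD[OF Suc.prems(1)] e by (auto simp: adj_def)
  have "subdiv_step\<^sup>*\<^sup>* ?G
    (verts ?G \<union> ?q ` {1..n}, edges ?G - {{?q 0, ?q (Suc n)}} \<union> path_edges ?q n)"
  proof (rule Suc.IH)
    show "wf_graph ?G" using Suc.prems(1) e fresh by (rule wf_graph_subdivide_edge)
    show "{?q 0, ?q (Suc n)} \<in> edges ?G" by (simp add: subdivide_edge_def)
    show "inj_on ?q {1..n}" using inj(1) by (rule comp_inj_on[OF inj_Suc])
    have "p 1 \<notin> ?q ` {1..n}" using inj(2) unfolding image_comp .
    then show "?q ` {1..n} \<inter> verts ?G = {}" using Suc.prems(4) inner by auto
  qed
  moreover have "verts ?G \<union> ?q ` {1..n} = verts G \<union> p ` {1..Suc n}"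
    unfolding inner by auto
  moreover have "edges ?G - {{?q 0, ?q (Suc n)}} \<union> path_edges ?q n =
      edges G - {?e} \<union> path_edges p (Suc n)"
    using new_end by (auto simp: subdivide_edge_def path_edges_Suc doubleton_eq_iff)
  moreover have "subdiv_step G ?G" using e fresh by (auto simp: subdiv_step_iff)
  ultimately show ?case by (metis converse_rtranclp_into_rtranclp)
qed

definition tail :: "'a set \<Rightarrow> 'a" where
  "tail e = (SOME x. x \<in> e)"

definition head :: "'a set \<Rightarrow> 'a" where
  "head e = (SOME y. e = {tail e, y})"

lemma tail_head_eq:
  assumes "card e = 2"
  shows "{tail e, head e} = e"
proof -
  obtain x y where e: "e = {x, y}" using assms unfolding card_2_iff by blast
  have "tail e \<in> e" unfolding tail_def by (rule someI[of _ x]) (simp add: e)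
  then have "\<exists>z. e = {tail e, z}" using e by auto
  then have "e = {tail e, head e}" unfolding head_def by (rule someI_ex)
  then show ?thesis by (rule sym)
qed

definition path_vertex :: "nat \<Rightarrow> 'a set \<Rightarrow> nat \<Rightarrow> 'a + 'a set \<times> nat" where
  "path_vertex n e k = (if k = 0 then Inl (tail e) else if k \<le> n then Inr (e, k) else Inl (head e))"

definition partial_subdivision :: "nat \<Rightarrow> 'a graph \<Rightarrow> 'a set set \<Rightarrow> ('a + 'a set \<times> nat) graph" where
  "partial_subdivision n H F = (Inl ` verts H \<union> Inr ` (F \<times> {1..n}),
     (`) Inl ` (edges H - F) \<union> (\<Union>e\<in>F. path_edges (path_vertex n e) n))"

definition uniform_subdivision :: "nat \<Rightarrow> 'a graph \<Rightarrow> ('a + 'a set \<times> nat) graph" where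
  "uniform_subdivision n H = partial_subdivision n H (edges H)"

lemma path_vertex_0 [simp]: "path_vertex n e 0 = Inl (tail e)"
  by (simp add: path_vertex_def)

lemma path_vertex_end [simp]: "path_vertex n e (Suc n) = Inl (head e)"
  by (simp add: path_vertex_def)

lemma path_vertex_inner [simp]: "k \<in> {1..n} \<Longrightarrow> path_vertex n e k = Inr (e, k)"
  by (simp add: path_vertex_def)

lemma path_vertex_ends:
  assumes "card e = 2"
  shows "{path_vertex n e 0, path_vertex n e (Suc n)} = Inl ` e"
proof -
  have "{path_vertex n e 0, path_vertex n e (Suc n)} = Inl ` {tail e, head e}" by simp
  then show ?thesis by (simp only: tail_head_eq[OF assms])
qed

lemma path_vertex_eq_Inr_iff: "path_vertex n e k = Inr (e', k') \<longleftrightarrow> e' = e \<and> k' = k \<and> k \<in> {1..n}"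
  by (auto simp: path_vertex_def)

lemma image_Inl_in_path_edges:
  assumes "card e = 2" "Inl ` e' \<in> path_edges (path_vertex n e) n"
  shows "e' = e"
proof -
  obtain k where k: "k \<le> n" "Inl ` e' = {path_vertex n e k, path_vertex n e (Suc k)}"
    using assms(2) by (auto simp: path_edges_def)
  have "k = 0" "n = 0"
  proof -
    have not_inner: "j \<notin> {1..n}" if "path_vertex n e j \<in> Inl ` e'" for j
      using that by (auto simp: path_vertex_def split: if_splits)
    show "k = 0" "n = 0" using not_inner[of k] not_inner[of "Suc k"] k by auto
  qed
  then have "Inl ` e' = (Inl ` e :: ('a + 'a set \<times> nat) set)"
    using k(2) path_vertex_ends[OF assms(1), of 0] by simp
  then show ?thesis by (simp only: inj_image_eq_iff[OF inj_Inl])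
qed

lemma edges_partial_subdivision_insert:
  assumes card: "\<And>e. e \<in> edges H \<Longrightarrow> card e = 2"
    and F: "F \<subseteq> edges H" and e: "e \<in> edges H" "e \<notin> F"
  shows "edges (partial_subdivision n H (insert e F)) =
    edges (partial_subdivision n H F) - {Inl ` e} \<union> path_edges (path_vertex n e) n"
proof -
  have "(`) Inl ` (edges H - insert e F) =
      (`) Inl ` (edges H - F) - {Inl ` e :: ('a + 'a set \<times> nat) set}"
    unfolding Diff_insert[of _ e F]
    by (subst image_set_diff) (simp_all add: inj_def inj_image_eq_iff)
  moreover have "Inl ` e \<notin> (\<Union>e'\<in>F. path_edges (path_vertex n e') n)"
    using image_Inl_in_path_edges card F e by blast
  ultimately show ?thesis by (auto simp: partial_subdivision_def)
qed

lemma subdiv_steps_partial_subdivision_insert: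
  assumes wf: "wf_graph H" "wf_graph (partial_subdivision n H F)"
    and F: "F \<subseteq> edges H" and e: "e \<in> edges H" "e \<notin> F"
  shows "subdiv_step\<^sup>*\<^sup>* (partial_subdivision n H F) (partial_subdivision n H (insert e F))"
    (is "subdiv_step\<^sup>*\<^sup>* ?G ?G'")
proof -
  let ?p = "path_vertex n e"
  have card: "card e = 2" if "e \<in> edges H" for e using wf(1) that by (simp add: wf_graph_def)
  have ends: "{?p 0, ?p (Suc n)} = Inl ` e" using card[OF e(1)] by (rule path_vertex_ends)
  have inner: "?p ` {1..n} = Inr ` ({e} \<times> {1..n})" by (auto simp: image_iff)
  have "subdiv_step\<^sup>*\<^sup>* ?G
    (verts ?G \<union> ?p ` {1..n}, edges ?G - {{?p 0, ?p (Suc n)}} \<union> path_edges ?p n)"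
  proof (rule subdiv_steps_path[OF wf(2)])
    show "{?p 0, ?p (Suc n)} \<in> edges ?G"
      unfolding ends using e by (simp add: partial_subdivision_def)
    show "inj_on ?p {1..n}" by (simp add: inj_on_def)
    show "?p ` {1..n} \<inter> verts ?G = {}"
      unfolding inner using e(2) by (auto simp: partial_subdivision_def)
  qed
  moreover have "verts ?G \<union> ?p ` {1..n} = verts ?G'"
    unfolding inner by (auto simp: partial_subdivision_def)
  moreover have "edges ?G - {Inl ` e} \<union> path_edges ?p n = edges ?G'"
    by (rule edges_partial_subdivision_insert[OF card F e, symmetric])
  ultimately show ?thesis by (simp only: ends graph_collapse)
qed

lemma subdiv_steps_uniform_subdivision:
  assumes wf: "wf_graph H"
  shows "subdiv_step\<^sup>*\<^sup>* (map_graph Inl H) (uniform_subdivision n H)"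
proof -
  have "subdiv_step\<^sup>*\<^sup>* (map_graph Inl H) (partial_subdivision n H F)" if "F \<subseteq> edges H" for F
    using finite_subset[OF that wf_graph_finite_edges[OF wf]] that
  proof (induction F rule: finite_induct)
    case empty
    then show ?case by (simp add: partial_subdivision_def map_graph_def)
  next
    case (insert e F)
    then have IH: "subdiv_step\<^sup>*\<^sup>* (map_graph Inl H) (partial_subdivision n H F)" by simp
    then have "wf_graph (partial_subdivision n H F)"
      by (rule wf_graph_subdiv_steps) (simp add: wf_graph_map_graph wf)
    then show ?case
      using IH subdiv_steps_partial_subdivision_insert[OF wf] insert by (auto intro: rtranclp_trans)
  qed
  then show ?thesis by (simp add: uniform_subdivision_def)
qed

lemma wf_graph_uniform_subdivision: "wf_graph H \<Longrightarrow> wf_graph (uniform_subdivision n H)"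
  using wf_graph_subdiv_steps[OF subdiv_steps_uniform_subdivision] wf_graph_map_graph inj_Inl
  by blast

lemma is_subdivision_of_uniform_subdivision:
  assumes wf: "wf_graph H"
  shows "is_subdivision_of (uniform_subdivision n H) H"
  using subdiv_steps_uniform_subdivision[OF wf] wf
  by (rule is_subdivision_of_subdiv_steps)
    (simp_all add: wf wf_graph_map_graph is_subdivision_of_map_graph)

lemma adj_uniform_subdivisionE:
  assumes "adj (uniform_subdivision n H) x y"
  obtains e k where "e \<in> edges H" "k \<le> n" "{x, y} = {path_vertex n e k, path_vertex n e (Suc k)}"
  using assms by (auto simp: adj_def uniform_subdivision_def partial_subdivision_def path_edges_def)

lemma adj_uniform_subdivision_inner:
  assumes "adj (uniform_subdivision n H) (Inr (e, k)) y"
  shows "y = path_vertex n e (k - 1) \<or> y = path_vertex n e (Suc k)"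
proof -
  obtain e' k' where "{Inr (e, k), y} = {path_vertex n e' k', path_vertex n e' (Suc k')}"
    using assms by (rule adj_uniform_subdivisionE)
  then show ?thesis
    by (auto simp: doubleton_eq_iff path_vertex_eq_Inr_iff dest: sym)
qed

lemma min_degree_2_contains_path:
  assumes D: "min_degree_2 G D"
    and nbrs: "\<And>k y. k \<in> {1..n} \<Longrightarrow> adj G (p k) y \<Longrightarrow> y = p (k - 1) \<or> y = p (Suc k)"
    and start: "i \<in> {1..n}" "p i \<in> D"
    and k: "k \<le> Suc n"
  shows "p k \<in> D"
proof -
  have spread: "p (k - 1) \<in> D \<and> p (Suc k) \<in> D" if "k \<in> {1..n}" "p k \<in> D" for k
    using min_degree_2D[OF D that(2)] nbrs[OF that(1)] by metis
  consider (above) "i \<le> k" | (below) "k \<le> i" by linarith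
  then show ?thesis
  proof cases
    case above
    then show ?thesis using k
    proof (induction k rule: dec_induct)
      case (step k)
      then show ?case using spread[of k] start(1) by simp
    qed (rule start(2))
  next
    case below
    then show ?thesis
    proof (induction k rule: inc_induct)
      case (step k)
      then show ?case using spread[of "Suc k"] start(1) by simp
    qed (rule start(2))
  qed
qed

lemma min_degree_2_uniform_subdivision:
  assumes D: "min_degree_2 (uniform_subdivision n H) D" and n: "n \<ge> 1"
  shows "\<exists>e\<in>edges H. \<forall>k\<in>{1..n}. Inr (e, k) \<in> D"
proof -
  obtain d where d: "d \<in> D" using D by (auto simp: min_degree_2_def)
  obtain x where x: "x \<in> D" "adj (uniform_subdivision n H) d x" using D d by (rule min_degree_2D)
  obtain e k where e: "e \<in> edges H" "k \<le> n"
    and dx: "{d, x} = {path_vertex n e k, path_vertex n e (Suc k)}"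
    using x(2) by (rule adj_uniform_subdivisionE)
  have in_D: "path_vertex n e k \<in> D" "path_vertex n e (Suc k) \<in> D"
    using d x(1) dx by (auto simp: doubleton_eq_iff)
  obtain i where i: "i \<in> {1..n}" "path_vertex n e i \<in> D"
  proof (cases "k = 0")
    case True
    then show thesis using that[of 1] in_D(2) n by simp
  next
    case False
    then show thesis using that[of k] in_D(1) e(2) by simp
  qed
  have "path_vertex n e j \<in> D" if "j \<le> Suc n" for j
    using D _ i that
    by (rule min_degree_2_contains_path) (auto dest!: adj_uniform_subdivision_inner)
  then show ?thesis using e(1) path_vertex_inner by (metis atLeastAtMost_iff le_SucI)
qed

section \<open>Gluing copies of a graph\<close>

text \<open>The vertices of the glued graph are the orbits of an involution \<open>\<sigma>\<close> on the
  disjoint union of the copies.\<close>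
definition glue :: "('z \<Rightarrow> 'z) \<Rightarrow> 'z \<Rightarrow> 'z set" where
  "glue \<sigma> z = {z, \<sigma> z}"

definition linked :: "'v graph \<Rightarrow> ('i \<times> 'v \<Rightarrow> 'i \<times> 'v) \<Rightarrow> 'i \<times> 'v \<Rightarrow> 'i \<times> 'v \<Rightarrow> bool" where
  "linked T \<sigma> z z' \<longleftrightarrow> (if fst z = fst z' then adj T (snd z) (snd z') else \<sigma> z = z \<and> \<sigma> z' = z')"

definition glued_copies :: "'i set \<Rightarrow> 'v graph \<Rightarrow> ('i \<times> 'v \<Rightarrow> 'i \<times> 'v) \<Rightarrow> ('i \<times> 'v) set graph" where
  "glued_copies I T \<sigma> = (glue \<sigma> ` (I \<times> verts T),
     {{glue \<sigma> z, glue \<sigma> z'} | z z'. z \<in> I \<times> verts T \<and> z' \<in> I \<times> verts T \<and> linked T \<sigma> z z'})"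

locale gluing =
  fixes I :: "'i set" and T :: "'v graph" and \<sigma> :: "'i \<times> 'v \<Rightarrow> 'i \<times> 'v"
  assumes finite_copies: "finite I"
    and wf_T: "wf_graph T"
    and involution: "\<sigma> (\<sigma> z) = z"
    and fixed_if_same_copy: "fst (\<sigma> z) = fst z \<Longrightarrow> \<sigma> z = z"
    and fixed_end: "adj T x y \<Longrightarrow> \<sigma> (i, x) = (i, x) \<or> \<sigma> (i, y) = (i, y)"
begin

abbreviation host :: "('i \<times> 'v) set graph" where
  "host \<equiv> glued_copies I T \<sigma>"

abbreviation copy :: "'i \<Rightarrow> ('i \<times> 'v) set set" where
  "copy i \<equiv> (\<lambda>x. glue \<sigma> (i, x)) ` verts T"

lemma glue_eq_iff: "glue \<sigma> z = glue \<sigma> z' \<longleftrightarrow> z' = z \<or> z' = \<sigma> z"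
  unfolding glue_def doubleton_eq_iff using involution by metis

lemma glue_eq_same_copy: "glue \<sigma> z = glue \<sigma> z' \<Longrightarrow> fst z = fst z' \<Longrightarrow> z = z'"
  using fixed_if_same_copy by (metis glue_eq_iff)

lemma linked_sym: "linked T \<sigma> z z' \<longleftrightarrow> linked T \<sigma> z' z"
  by (auto simp: linked_def adj_sym)

lemma linked_fixed_end: "linked T \<sigma> z z' \<Longrightarrow> \<sigma> z = z \<or> \<sigma> z' = z'"
  using fixed_end by (metis linked_def prod.collapse)

lemma linked_glue_neq:
  assumes "linked T \<sigma> z z'"
  shows "glue \<sigma> z \<noteq> glue \<sigma> z'"
  using assms wf_graph_adjD(3)[OF wf_T] glue_eq_same_copy glue_eq_iff
  unfolding linked_def by metis

lemma adj_host_iff: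
  "adj host c d \<longleftrightarrow> (\<exists>z\<in>I \<times> verts T. \<exists>z'\<in>I \<times> verts T. linked T \<sigma> z z' \<and> c = glue \<sigma> z \<and> d = glue \<sigma> z')"
proof
  assume "adj host c d"
  then obtain z z' where "z \<in> I \<times> verts T" "z' \<in> I \<times> verts T" "linked T \<sigma> z z'"
    "{c, d} = {glue \<sigma> z, glue \<sigma> z'}"
    unfolding adj_def glued_copies_def edges_Pair mem_Collect_eq by (elim exE conjE)
  then show "\<exists>z\<in>I \<times> verts T. \<exists>z'\<in>I \<times> verts T. linked T \<sigma> z z' \<and> c = glue \<sigma> z \<and> d = glue \<sigma> z'"
    using linked_sym unfolding doubleton_eq_iff by metis
qed (auto simp: adj_def glued_copies_def)

lemma adj_hostE:
  assumes "adj host c d"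
  obtains z z' where "z \<in> I \<times> verts T" "z' \<in> I \<times> verts T" "linked T \<sigma> z z'"
    "c = glue \<sigma> z" "d = glue \<sigma> z'"
  using assms unfolding adj_host_iff by blast

lemma copy_subset_host: "i \<in> I \<Longrightarrow> copy i \<subseteq> verts host"
  by (auto simp: glued_copies_def)

lemma wf_graph_host: "wf_graph host"
proof -
  have "finite (verts host)"
    using finite_copies wf_T by (simp add: glued_copies_def wf_graph_def)
  moreover have "e \<subseteq> verts host \<and> card e = 2" if "e \<in> edges host" for e
    using that linked_glue_neq by (auto simp: glued_copies_def)
  ultimately show ?thesis by (simp add: wf_graph_def)
qed

lemma adj_host_same_copy:
  assumes "adj host (glue \<sigma> z) (glue \<sigma> z')" "fst z = fst z'"
  shows "linked T \<sigma> z z'"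
proof -
  obtain y y' where y: "linked T \<sigma> y y'" "glue \<sigma> z = glue \<sigma> y" "glue \<sigma> z' = glue \<sigma> y'"
    using assms(1) by (rule adj_hostE)
  then have "y = z \<or> y = \<sigma> z" "y' = z' \<or> y' = \<sigma> z'" by (auto simp: glue_eq_iff)
  moreover from this have "y = z \<or> y' = z'"
    using linked_fixed_end[OF y(1)] involution by metis
  ultimately show ?thesis
    using y(1) assms(2) fixed_if_same_copy involution unfolding linked_def by metis
qed

lemma iso_map_copy:
  assumes i: "i \<in> I"
  shows "iso_map (\<lambda>x. glue \<sigma> (i, x)) T (induced_subgraph host (copy i))"
proof -
  have "inj_on (\<lambda>x. glue \<sigma> (i, x)) (verts T)"
    using glue_eq_same_copy by (fastforce intro: inj_onI)
  moreover have "adj host (glue \<sigma> (i, x)) (glue \<sigma> (i, y)) \<longleftrightarrow> adj T x y"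
    if "x \<in> verts T" "y \<in> verts T" for x y
  proof
    show "adj host (glue \<sigma> (i, x)) (glue \<sigma> (i, y)) \<Longrightarrow> adj T x y"
      using adj_host_same_copy[of "(i, x)" "(i, y)"] by (simp add: linked_def)
    show "adj T x y \<Longrightarrow> adj host (glue \<sigma> (i, x)) (glue \<sigma> (i, y))"
      using that i unfolding adj_host_iff by (force simp: linked_def)
  qed
  ultimately show ?thesis by (auto simp: iso_map_def bij_betw_def)
qed

lemma induced_subdiv_copy:
  assumes "is_subdivision_of T H" "i \<in> I"
  shows "induced_subdiv host H (copy i)"
  using assms is_subdivision_of_iso_map iso_map_copy copy_subset_host
  unfolding induced_subdiv_def by blast

lemma card_hitting_copies:
  assumes X: "X \<subseteq> verts host" and hit: "\<And>i. i \<in> I \<Longrightarrow> copy i \<inter> X \<noteq> {}"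
  shows "card I \<le> 2 * card X"
proof -
  have finite_X: "finite X" using X wf_graph_host finite_subset unfolding wf_graph_def by blast
  have orbit: "finite (fst ` c)" "card (fst ` c) \<le> 2" if c: "c \<in> X" for c
  proof -
    obtain z where "c = glue \<sigma> z"
      using X c unfolding glued_copies_def verts_Pair by blast
    then have "fst ` c = {fst z, fst (\<sigma> z)}" by (simp add: glue_def)
    then show "finite (fst ` c)" "card (fst ` c) \<le> 2" by (simp_all add: card_insert_if)
  qed
  have "I \<subseteq> (\<Union>c\<in>X. fst ` c)" using hit by (fastforce simp: glue_def)
  then have "card I \<le> card (\<Union>c\<in>X. fst ` c)"
    using finite_X orbit(1) by (intro card_mono) auto
  also have "\<dots> \<le> (\<Sum>c\<in>X. card (fst ` c))" using finite_X by (rule card_UN_le)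
  also have "\<dots> \<le> (\<Sum>c\<in>X. 2)" using orbit(2) by (rule sum_mono)
  finally show ?thesis by simp
qed

lemma far_core_in_copy:
  assumes D: "far_core host D"
  shows "\<exists>i\<in>I. D \<subseteq> copy i"
proof -
  obtain a b where "adj host a b" and anti: "\<And>d. d \<in> D \<Longrightarrow> \<not> adj host a d \<and> \<not> adj host b d"
    using D by (auto simp: far_core_def)
  then obtain z z' where "z \<in> I \<times> verts T" "z' \<in> I \<times> verts T" "linked T \<sigma> z z'"
    "a = glue \<sigma> z" "b = glue \<sigma> z'"
    by (elim adj_hostE)
  then obtain y where y: "y \<in> I \<times> verts T" "\<sigma> y = y" "glue \<sigma> y \<in> {a, b}"
    using linked_fixed_end by blast
  have fixed_in_copy: "fst z = fst y" if "z \<in> I \<times> verts T" "\<sigma> z = z" "glue \<sigma> z \<in> D" for z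
  proof (rule ccontr)
    assume "fst z \<noteq> fst y"
    then have "adj host (glue \<sigma> y) (glue \<sigma> z)"
      using that y unfolding adj_host_iff linked_def by metis
    then show False using anti that(3) y(3) by blast
  qed
  have "d \<in> copy (fst y)" if d: "d \<in> D" for d
  proof -
    obtain d' where d': "d' \<in> D" "adj host d d'"
      using D d unfolding far_core_def min_degree_2_def by blast
    then obtain z z' where z: "z \<in> I \<times> verts T" "z' \<in> I \<times> verts T" "linked T \<sigma> z z'"
      "d = glue \<sigma> z" "d' = glue \<sigma> z'"
      by (elim adj_hostE)
    then have "fst z = fst y"
      using fixed_in_copy[of z] fixed_in_copy[of z'] linked_fixed_end[OF z(3)] d d'(1)
      unfolding linked_def by metis
    then show ?thesis using z(1,4) by force
  qed
  then show ?thesis using y(1) by force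
qed

lemma far_core_host:
  assumes D: "far_core host D"
  shows "\<exists>i\<in>I. \<exists>D'. min_degree_2 T D' \<and> (\<forall>x\<in>D'. glue \<sigma> (i, x) \<in> D)"
proof -
  obtain i where i: "i \<in> I" "D \<subseteq> copy i" using far_core_in_copy[OF D] by blast
  let ?g = "\<lambda>x. glue \<sigma> (i, x)"
  let ?D = "inv_into (verts T) ?g ` D"
  have "min_degree_2 (induced_subgraph host (copy i)) D"
    using D i copy_subset_host by (simp add: min_degree_2_induced_subgraph far_core_def)
  then have "min_degree_2 T ?D"
    by (rule min_degree_2_image[OF iso_map_inv[OF iso_map_copy[OF i(1)]]])
  moreover have "?g ` ?D = D" using i(2) by (rule image_inv_into_cancel[OF refl])
  ultimately show ?thesis using i(1) by blast
qed

end

section \<open>The host graph\<close>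

fun crossing :: "nat \<times> ('a + 'a set \<times> nat) \<Rightarrow> nat \<times> ('a + 'a set \<times> nat)" where
  "crossing (i, Inl a) = (i, Inl a)"
| "crossing (i, Inr (e, k)) = (if even k then (k div 2, Inr (e, 2 * i)) else (i, Inr (e, k)))"

definition crossing_copies :: "'a graph \<Rightarrow> nat \<Rightarrow> (nat \<times> ('a + 'a set \<times> nat)) set graph" where
  "crossing_copies H N = glued_copies {1..N} (uniform_subdivision (2 * N + 1) H) crossing"

lemma gluing_crossing:
  assumes wf: "wf_graph H"
  shows "gluing {1..N} (uniform_subdivision n H) crossing"
proof
  show "wf_graph (uniform_subdivision n H)" using wf by (rule wf_graph_uniform_subdivision)
next
  fix z :: "nat \<times> ('a + 'a set \<times> nat)"
  show "crossing (crossing z) = z" by (cases z rule: crossing.cases) auto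
  show "fst (crossing z) = fst z \<Longrightarrow> crossing z = z"
    by (cases z rule: crossing.cases) (auto split: if_splits)
next
  fix x y and i :: nat assume "adj (uniform_subdivision n H) x y"
  then obtain e k where xy: "{x, y} = {path_vertex n e k, path_vertex n e (Suc k)}"
    by (rule adj_uniform_subdivisionE)
  have "crossing (i, path_vertex n e j) = (i, path_vertex n e j)" if "odd j" for j
    using that by (simp add: path_vertex_def)
  then have "crossing (i, path_vertex n e k) = (i, path_vertex n e k) \<or>
      crossing (i, path_vertex n e (Suc k)) = (i, path_vertex n e (Suc k))"
    by (cases "odd k") simp_all
  then show "crossing (i, x) = (i, x) \<or> crossing (i, y) = (i, y)"
    using xy by (auto simp: doubleton_eq_iff)
qed simp

lemma wf_graph_crossing_copies: "wf_graph H \<Longrightarrow> wf_graph (crossing_copies H N)"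
  unfolding crossing_copies_def by (intro gluing.wf_graph_host gluing_crossing)

lemma card_hitting_set_crossing_copies:
  assumes wf: "wf_graph H" and X: "hitting_set (crossing_copies H N) H X"
  shows "N \<le> 2 * card X"
proof -
  interpret gluing "{1..N}" "uniform_subdivision (2 * N + 1) H" crossing
    using wf by (rule gluing_crossing)
  have "card {1..N} \<le> 2 * card X"
    using X induced_subdiv_copy[OF is_subdivision_of_uniform_subdivision[OF wf]]
    unfolding hitting_set_def crossing_copies_def by (intro card_hitting_copies) blast+
  then show ?thesis by simp
qed

lemma far_core_crossing_copies:
  assumes wf: "wf_graph H" and D: "far_core (crossing_copies H N) D"
  shows "\<exists>e\<in>edges H. \<exists>i\<in>{1..N}. \<forall>j\<in>{1..N}. glue crossing (i, Inr (e, 2 * j)) \<in> D"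
proof -
  interpret gluing "{1..N}" "uniform_subdivision (2 * N + 1) H" crossing
    using wf by (rule gluing_crossing)
  obtain i D' where i: "i \<in> {1..N}" and D': "min_degree_2 (uniform_subdivision (2 * N + 1) H) D'"
    "\<And>x. x \<in> D' \<Longrightarrow> glue crossing (i, x) \<in> D"
    using far_core_host D unfolding crossing_copies_def by blast
  obtain e where e: "e \<in> edges H" "\<And>k. k \<in> {1..2 * N + 1} \<Longrightarrow> Inr (e, k) \<in> D'"
    using min_degree_2_uniform_subdivision[OF D'(1)] by auto
  have "glue crossing (i, Inr (e, 2 * j)) \<in> D" if "j \<in> {1..N}" for j
    using that by (intro D'(2) e(2)) auto
  then show ?thesis using e(1) i by blast
qed

lemma glue_crossing_swap:
  "glue crossing (i, Inr (e, 2 * j)) = glue crossing (j, Inr (e, 2 * i))"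
  by (auto simp: glue_def)

lemma card_packing_crossing_copies:
  assumes wf: "wf_graph H" and D: "far_core H D" and F: "induced_packing (crossing_copies H N) H F"
  shows "card F \<le> card (edges H)"
proof -
  have "\<exists>e\<in>edges H. \<exists>i\<in>{1..N}. \<forall>j\<in>{1..N}. glue crossing (i, Inr (e, 2 * j)) \<in> S" if "S \<in> F" for S
  proof -
    have "induced_subdiv (crossing_copies H N) H S" using F that by (simp add: induced_packing_def)
    then obtain D' where "D' \<subseteq> S" "far_core (crossing_copies H N) D'"
      using far_core_induced_subdiv[OF wf D] by blast
    then show ?thesis using far_core_crossing_copies[OF wf] by blast
  qed
  then obtain edge copy where edge: "\<And>S. S \<in> F \<Longrightarrow> edge S \<in> edges H"
    and copy: "\<And>S. S \<in> F \<Longrightarrow> copy S \<in> {1..N}"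
    and path: "\<And>S j. S \<in> F \<Longrightarrow> j \<in> {1..N} \<Longrightarrow> glue crossing (copy S, Inr (edge S, 2 * j)) \<in> S"
    by metis
  have "inj_on edge F"
  proof (rule inj_onI)
    fix S S' assume S: "S \<in> F" "S' \<in> F" and eq: "edge S = edge S'"
    have "glue crossing (copy S, Inr (edge S, 2 * copy S')) \<in> S'"
      using path[OF S(2) copy[OF S(1)]] by (simp only: eq glue_crossing_swap[of "copy S"])
    then show "S = S'"
      using path[OF S(1) copy[OF S(2)]] F S
      unfolding induced_packing_def pairwise_def disjnt_def by blast
  qed
  then show ?thesis
    using edge wf_graph_finite_edges[OF wf] by (intro card_inj_on_le) auto
qed

theorem mainTheorem5:
  fixes H :: "'a graph" and C :: "'a list" and u v :: 'a
  assumes "wf_graph H"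
    and "is_cycle H C"
    and "adj H u v"
    and "\<forall>w\<in>set C. \<not> adj H u w \<and> \<not> adj H v w"
  shows "\<not> induced_EP H"
proof (rule not_induced_EP_if_bounded_packings)
  fix N
  show "wf_graph (crossing_copies H (2 * N))" using assms(1) by (rule wf_graph_crossing_copies)
  have "far_core H (set C)"
    using assms(3,4) min_degree_2_cycle[OF assms(2)] wf_graph_adjD[OF assms(1,3)]
    unfolding far_core_def by blast
  then show "card F \<le> card (edges H)" if "induced_packing (crossing_copies H (2 * N)) H F" for F
    using that by (rule card_packing_crossing_copies[OF assms(1)])
  show "N \<le> card X" if "hitting_set (crossing_copies H (2 * N)) H X" for X
    using card_hitting_set_crossing_copies[OF assms(1) that] by simp
qed

end
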